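(* A graph $G$ on vertices $v_1,\dots,v_n$ admits a triangle-free exact-distance square root if and only if there is a collection $Cl_1,\dots,Cl_n$ of cliques of $G$ satisfying: (a) $v_i\notin Cl_i$ for each $i$; (b) for each pair $i,j$, if $v_i\in Cl_j$ then $v_j\in Cl_i$; (c) for distinct $i,j$, $v_i\sim v_j$ in $G$ if and only if $Cl_i\cap Cl_j\neq\emptyset$; (d) for each $i\in[n]$ and each pair $v_j,v_k$ of vertices of $Cl_i$, we have $v_j\notin Cl_k$.
   Context: All graphs are finite and simple. A clique of $G$ is a set of vertices inducing a complete subgraph. For a graph $H=(V,E)$, its exact-distance square $H^{[\sharp 2]}$ is the graph with vertex set $V$ in which distinct vertices $x,y$ are adjacent if and only if their distance in $H$ is exactly $2$; $H$ is an exact-distance square root of $G$ if $V(H)=V(G)$ and $H^{[\sharp 2]}=G$. *)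

theory Defs
  imports "Graph_Theory.Graph_Theory"
begin

text \<open>
  Finite simple graphs are the library's \<^locale>\<open>pair_graph\<close>: finite, symmetric, loop-free
  digraphs whose arcs are ordered pairs of vertices. The null graph is allowed.
\<close>

text \<open>The empty set and singletons count as cliques.\<close>

definition is_clique :: "'a pair_pre_digraph \<Rightarrow> 'a set \<Rightarrow> bool" where
  "is_clique G S \<longleftrightarrow>
     S \<subseteq> pverts G \<and> complete_digraph (card S) (induce_subgraph (with_proj G) S)"

definition triangle_free :: "'a pair_pre_digraph \<Rightarrow> bool" where
  "triangle_free H \<longleftrightarrow> \<not> (\<exists>T. is_clique H T \<and> card T = 3)"

text \<open>
  With unit arc weights, \<^const>\<open>wf_digraph.\<mu>\<close> (infimum of the weights of all walks) is the
  usual graph distance, infinite between different components.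
\<close>

definition graph_dist :: "'a pair_pre_digraph \<Rightarrow> 'a \<Rightarrow> 'a \<Rightarrow> ereal" where
  "graph_dist H x y = wf_digraph.\<mu> (with_proj H) (\<lambda>_. 1) x y"

definition exact_dist_square :: "'a pair_pre_digraph \<Rightarrow> 'a pair_pre_digraph" where
  "exact_dist_square H =
     \<lparr> pverts = pverts H,
       parcs = {(x, y). x \<in> pverts H \<and> y \<in> pverts H \<and> x \<noteq> y \<and> graph_dist H x y = 2} \<rparr>"

definition exact_dist_square_root :: "'a pair_pre_digraph \<Rightarrow> 'a pair_pre_digraph \<Rightarrow> bool" where
  "exact_dist_square_root H G \<longleftrightarrow>
     pair_graph H \<and> pverts H = pverts G \<and> exact_dist_square H = G"

end

theory Submission
  imports Defs
begin

text \<open>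
  In a triangle-free graph the ends of a path of length two are never adjacent, so two distinct
  vertices are at distance exactly two if and only if they have a common neighbour. Hence the sets
  \<open>Cl i\<close> of the theorem are just the neighbourhoods in \<open>H\<close> of the vertices \<open>v i\<close>: (a) says that
  \<open>H\<close> is loop-free, (b) that it is symmetric, (d) that it is triangle-free, and (c) that its
  exact-distance square is \<open>G\<close>.
\<close>

lemma (in pair_graph) is_clique_iff:
  "is_clique G S \<longleftrightarrow> S \<subseteq> pverts G \<and> (\<forall>x\<in>S. \<forall>y\<in>S. x \<noteq> y \<longrightarrow> (x, y) \<in> parcs G)"
proof (cases "S \<subseteq> pverts G")
  case True
  let ?I = "\<lparr> pverts = S, parcs = {e \<in> parcs G. fst e \<in> S \<and> snd e \<in> S} \<rparr>"
  \<comment> \<open>\<open>complete_digraph_pair_def\<close> applies only to digraphs of the form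
    \<open>with_proj\<close>, so the induced subgraph is first brought into that form.\<close>
  have induced: "induce_subgraph (with_proj G) S = with_proj ?I"
    by (simp add: induce_subgraph_def with_proj_def)
  have "finite S"
    using True pair_finite_verts by (rule finite_subset)
  \<comment> \<open>Loop-freeness gives the inclusion from left to right; the converse inclusion is
    pairwise adjacency.\<close>
  moreover have "parcs ?I = {(u, w). (u, w) \<in> S \<times> S \<and> u \<noteq> w} \<longleftrightarrow>
      (\<forall>x\<in>S. \<forall>y\<in>S. x \<noteq> y \<longrightarrow> (x, y) \<in> parcs G)"
    using pair_no_loops by fastforce
  ultimately show ?thesis
    using True unfolding is_clique_def induced complete_digraph_pair_def by simp
qed (simp add: is_clique_def)

text \<open>Three arcs, one per side, suffice: distinctness of the corners follows from the absence
  of loops, and the reversed arcs from symmetry.\<close>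

lemma (in pair_graph) triangle_free_iff:
  "triangle_free G \<longleftrightarrow>
    \<not> (\<exists>x y z. (x, y) \<in> parcs G \<and> (y, z) \<in> parcs G \<and> (x, z) \<in> parcs G)" (is "_ \<longleftrightarrow> \<not> ?T")
proof -
  have "(\<exists>T. is_clique G T \<and> card T = 3) \<longleftrightarrow> ?T"
  proof
    assume "\<exists>T. is_clique G T \<and> card T = 3"
    then obtain x y z where "is_clique G {x, y, z}" "x \<noteq> y" "y \<noteq> z" "x \<noteq> z"
      by (auto simp: card_3_iff)
    then show ?T by (auto simp: is_clique_iff)
  next
    assume ?T
    then obtain x y z where xyz: "(x, y) \<in> parcs G" "(y, z) \<in> parcs G" "(x, z) \<in> parcs G"
      by blast
    then have "x \<noteq> y" "y \<noteq> z" "x \<noteq> z"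
      using pair_no_loops by fastforce+
    moreover have "(y, x) \<in> parcs G" "(z, y) \<in> parcs G" "(z, x) \<in> parcs G"
      using xyz arcs_symmetric by blast+
    ultimately have "is_clique G {x, y, z}" "card {x, y, z} = 3"
      using xyz by (auto simp: is_clique_iff dest: wellformed')
    then show "\<exists>T. is_clique G T \<and> card T = 3" by blast
  qed
  then show ?thesis by (simp add: triangle_free_def)
qed

lemma (in wf_digraph) awalk_cost_const_1: "awalk_cost (\<lambda>_. 1) p = real (length p)"
  by (induction p) auto

text \<open>With unit weights the cost of a walk is its length. A shortest path of length two
  exhibits the middle vertex; conversely, distinctness and non-adjacency rule out walks of length
  zero and one.\<close>

lemma (in pair_fin_digraph) graph_dist_eq_2_iff:
  assumes "x \<noteq> y"
  shows "graph_dist G x y = 2 \<longleftrightarrow>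
    (x, y) \<notin> parcs G \<and> (\<exists>z. (x, z) \<in> parcs G \<and> (z, y) \<in> parcs G)"
proof
  assume dist: "graph_dist G x y = 2"
  \<comment> \<open>Finite distance means reachability, and then the infimum in \<open>\<mu>\<close>
    is attained by a path.\<close>
  have "x \<rightarrow>\<^sup>*\<^bsub>with_proj G\<^esub> y"
    using dist unfolding graph_dist_def \<mu>_reach_conv[of "\<lambda>_. 1", symmetric] by simp
  then obtain p where "apath x p y" and "\<mu> (\<lambda>_. 1) x y = awalk_cost (\<lambda>_. 1) p"
    using min_cost_awalk[of x y "\<lambda>_. 1"] by auto
  then have p: "awalk x p y" and "length p = 2"
    using dist by (auto simp: graph_dist_def apath_def awalk_cost_const_1)
  from \<open>length p = 2\<close> obtain e f where "p = [e, f]"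
    by (auto simp: length_Suc_conv numeral_2_eq_2)
  then have "(x, snd e) \<in> parcs G \<and> (snd e, y) \<in> parcs G"
    using p by (cases e, cases f) (auto simp: awalk_simps)
  moreover have "(x, y) \<notin> parcs G"
  proof
    assume "(x, y) \<in> parcs G"
    \<comment> \<open>An arc is a walk of cost 1, which would push the distance below 2.\<close>
    then have "awalk x [(x, y)] y"
      by (auto simp: awalk_simps dest: wellformed')
    from min_cost_le_walk_cost[OF this, of "\<lambda>_. 1"] show False
      using dist by (simp add: graph_dist_def)
  qed
  ultimately show "(x, y) \<notin> parcs G \<and> (\<exists>z. (x, z) \<in> parcs G \<and> (z, y) \<in> parcs G)"
    by blast
next
  assume "(x, y) \<notin> parcs G \<and> (\<exists>z. (x, z) \<in> parcs G \<and> (z, y) \<in> parcs G)"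
  then obtain z where nonadj: "(x, y) \<notin> parcs G" and z: "(x, z) \<in> parcs G" "(z, y) \<in> parcs G"
    by blast
  have "awalk x [(x, z), (z, y)] y"
    using z by (auto simp: awalk_simps dest: wellformed')
  from min_cost_le_walk_cost[OF this, of "\<lambda>_. 1"] have "graph_dist G x y \<le> 2"
    by (simp add: graph_dist_def)
  moreover have "2 \<le> awalk_cost (\<lambda>_. 1) p" if p: "awalk x p y" for p
  proof (cases p)
    case Nil
    then show ?thesis using p assms by (simp add: awalk_Nil_iff)
  next
    case (Cons e q)
    have "q \<noteq> []"
      using p Cons nonadj by (cases e) (auto simp: awalk_simps)
    then have "2 \<le> length p" using Cons by (cases q) auto
    then show ?thesis by (simp add: awalk_cost_const_1)
  qed
  then have "2 \<le> graph_dist G x y"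
    unfolding graph_dist_def \<mu>_def by (intro INF_greatest) simp
  ultimately show "graph_dist G x y = 2" by (rule antisym)
qed

lemma (in pair_graph) parcs_exact_dist_square_iff:
  assumes "triangle_free G"
  shows "(x, y) \<in> parcs (exact_dist_square G) \<longleftrightarrow>
    x \<noteq> y \<and> (\<exists>z. (x, z) \<in> parcs G \<and> (z, y) \<in> parcs G)"
  using assms graph_dist_eq_2_iff[of x y]
  by (auto simp: exact_dist_square_def triangle_free_iff dest: wellformed')

theorem theorem7:
  fixes G :: "'a pair_pre_digraph" and n :: nat and v :: "nat \<Rightarrow> 'a"
  assumes "pair_graph G"
    and "bij_betw v {1..n} (pverts G)"
  shows "(\<exists>H. exact_dist_square_root H G \<and> triangle_free H) \<longleftrightarrow>
    (\<exists>Cl :: nat \<Rightarrow> 'a set.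
       (\<forall>i\<in>{1..n}. is_clique G (Cl i)) \<and>
       (\<forall>i\<in>{1..n}. v i \<notin> Cl i) \<and>
       (\<forall>i\<in>{1..n}. \<forall>j\<in>{1..n}. v i \<in> Cl j \<longrightarrow> v j \<in> Cl i) \<and>
       (\<forall>i\<in>{1..n}. \<forall>j\<in>{1..n}. i \<noteq> j \<longrightarrow>
          ((v i, v j) \<in> parcs G \<longleftrightarrow> Cl i \<inter> Cl j \<noteq> {})) \<and>
       (\<forall>i\<in>{1..n}. \<forall>j\<in>{1..n}. \<forall>k\<in>{1..n}.
          v j \<in> Cl i \<longrightarrow> v k \<in> Cl i \<longrightarrow> v j \<notin> Cl k))"
  (is "_ \<longleftrightarrow> (\<exists>Cl. ?cliques Cl \<and> ?a Cl \<and> ?b Cl \<and> ?c Cl \<and> ?d Cl)")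
proof
  interpret G: pair_graph G by fact
  assume "\<exists>H. exact_dist_square_root H G \<and> triangle_free H"
  then obtain H where H: "pair_graph H" "pverts H = pverts G" "exact_dist_square H = G"
    and tf: "triangle_free H"
    by (auto simp: exact_dist_square_root_def)
  interpret H: pair_graph H by fact
  define Cl where "Cl i = {u. (v i, u) \<in> parcs H}" for i
  have sym: "(x, y) \<in> parcs H \<longleftrightarrow> (y, x) \<in> parcs H" for x y
    using H.arcs_symmetric by blast
  have adj: "(x, y) \<in> parcs G \<longleftrightarrow> x \<noteq> y \<and> (\<exists>z. (x, z) \<in> parcs H \<and> (z, y) \<in> parcs H)" for x y
    using H.parcs_exact_dist_square_iff[OF tf] H(3) by simp
  have no_triangle: "(y, z) \<notin> parcs H" if "(x, y) \<in> parcs H" "(x, z) \<in> parcs H" for x y z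
    using tf that unfolding H.triangle_free_iff by blast
  have loop: "(x, x) \<notin> parcs H" for x
    using H.pair_no_loops by fastforce
  have inj: "v i \<noteq> v j" if "i \<in> {1..n}" "j \<in> {1..n}" "i \<noteq> j" for i j
    using assms(2) that unfolding bij_betw_def by (meson inj_onD)
  \<comment> \<open>Two distinct neighbours of \<open>v i\<close> have \<open>v i\<close> itself as
    a common neighbour, hence are adjacent in the exact-distance square.\<close>
  have "?cliques Cl"
    using sym by (auto simp: Cl_def G.is_clique_iff adj H(2)[symmetric] dest: H.wellformed')
  moreover have "?a Cl"
    using loop by (simp add: Cl_def)
  moreover have "?b Cl"
    using sym by (simp add: Cl_def)
  moreover have "?c Cl"
    using sym inj by (auto simp: Cl_def adj)
  moreover have "?d Cl"
    using no_triangle unfolding Cl_def by blast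
  ultimately show "\<exists>Cl. ?cliques Cl \<and> ?a Cl \<and> ?b Cl \<and> ?c Cl \<and> ?d Cl"
    by blast
next
  interpret G: pair_graph G by fact
  assume "\<exists>Cl. ?cliques Cl \<and> ?a Cl \<and> ?b Cl \<and> ?c Cl \<and> ?d Cl"
  then obtain Cl where cliques: "?cliques Cl" and a: "?a Cl" and b: "?b Cl" and c: "?c Cl"
    and d: "?d Cl"
    by blast
  \<comment> \<open>This makes \<open>Cl i\<close> the neighbourhood of \<open>v i\<close>. The
    index bounds matter because \<open>Cl\<close> is arbitrary outside
    \<open>{1..n}\<close>.\<close>
  define E where "E = {(v i, v j) | i j. i \<in> {1..n} \<and> j \<in> {1..n} \<and> v j \<in> Cl i}"
  define H where "H = \<lparr> pverts = pverts G, parcs = E \<rparr>"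
  have inj: "v i = v j \<longleftrightarrow> i = j" if "i \<in> {1..n}" "j \<in> {1..n}" for i j
    using assms(2) that unfolding bij_betw_def by (meson inj_onD)
  have img: "pverts G = v ` {1..n}"
    using assms(2) by (simp add: bij_betw_def)
  \<comment> \<open>Since \<open>v\<close> is injective, an arc determines its indices and can be
    read back as a membership.\<close>
  have E_iff: "(v i, v j) \<in> E \<longleftrightarrow> v j \<in> Cl i" if "i \<in> {1..n}" "j \<in> {1..n}" for i j
    using that inj unfolding E_def by blast
  have E_subset: "E \<subseteq> pverts G \<times> pverts G"
    unfolding E_def img by blast
  have E_sym: "(y, x) \<in> E" if "(x, y) \<in> E" for x y
    using that b unfolding E_def by blast
  interpret H: pair_graph H
  proof
    show "finite (pverts H)" "finite (parcs H)"
      using E_subset G.pair_finite_verts by (auto simp: H_def intro: finite_subset)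
    show "symmetric (with_proj H)"
      using E_sym by (auto simp: H_def symmetric_def sym_def)
    show "fst e \<noteq> snd e" if "e \<in> parcs H" for e
      using that a inj by (auto simp: H_def E_def)
  qed (use E_subset in \<open>auto simp: H_def\<close>)
  have tf: "triangle_free H"
    unfolding H.triangle_free_iff
  proof
    assume "\<exists>x y z. (x, y) \<in> parcs H \<and> (y, z) \<in> parcs H \<and> (x, z) \<in> parcs H"
    then obtain x y z where xyz: "(x, y) \<in> E" "(y, z) \<in> E" "(x, z) \<in> E"
      by (auto simp: H_def)
    then obtain i j k where "i \<in> {1..n}" "j \<in> {1..n}" "k \<in> {1..n}" "x = v i" "y = v j" "z = v k"
      using E_subset img by blast
    \<comment> \<open>Condition (d) for \<open>v k\<close> and \<open>v j\<close> in
      \<open>Cl i\<close>, in this order, yields \<open>v k \<notin> Cl j\<close>, against the arc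
      from \<open>y\<close> to \<open>z\<close>.\<close>
    then show False using xyz d E_iff by metis
  qed
  have "(x, y) \<in> parcs (exact_dist_square H) \<longleftrightarrow> (x, y) \<in> parcs G" for x y
  proof (cases "x \<in> pverts G \<and> y \<in> pverts G \<and> x \<noteq> y")
    case True
    then obtain i j where ij: "i \<in> {1..n}" "j \<in> {1..n}" "x = v i" "y = v j"
      using img by blast
    \<comment> \<open>Symmetry turns the arc from \<open>z\<close> to \<open>y\<close> around, so
      that it becomes membership of \<open>z\<close> in \<open>Cl j\<close>.\<close>
    have "(\<exists>z. (x, z) \<in> E \<and> (z, y) \<in> E) \<longleftrightarrow> (\<exists>k\<in>{1..n}. v k \<in> Cl i \<and> v k \<in> Cl j)"
      using ij E_iff E_subset E_sym img by (smt (verit) imageE mem_Sigma_iff subsetD)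
    \<comment> \<open>Cliques consist of vertices, so every common element is some
      \<open>v k\<close>.\<close>
    also have "\<dots> \<longleftrightarrow> Cl i \<inter> Cl j \<noteq> {}"
      using cliques ij unfolding G.is_clique_iff img by blast
    also have "\<dots> \<longleftrightarrow> (x, y) \<in> parcs G"
      using c ij True by metis
    finally show ?thesis
      using True by (simp add: H.parcs_exact_dist_square_iff[OF tf]) (simp add: H_def)
  next
    \<comment> \<open>Neither graph has loops or arcs with an end outside the vertex set, so both
      sides are false.\<close>
    case False
    then show ?thesis
      using G.wellformed' G.pair_no_loops
      by (fastforce simp: exact_dist_square_def H_def)
  qed
  then have "exact_dist_square H = G"
    by (intro pair_pre_digraph.equality) (auto simp: exact_dist_square_def H_def)
  then have "exact_dist_square_root H G"
    using H.pair_graph_axioms by (simp add: exact_dist_square_root_def H_def)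
  then show "\<exists>H. exact_dist_square_root H G \<and> triangle_free H"
    using tf by blast
qed

end
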